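(* Let $\mathbb{F}_q$ be a finite field of even characteristic, let $a,b\in\mathbb{F}_q$ with $b\ne0$, let $n\ge2$ and $k\ge1$ be integers, and let $C_n^k(a,b)$ be the linear code over $\mathbb{F}_q$ with generator matrix $(I_n\ T_n(a,b,b)^k)$. Let $r$ be the largest integer such that $n+1=2^r(m+1)$ for an integer $m$, and write $k=2^tk'$ with $\gcd(k',q)=1$. Let $\mu$ be a primitive $k'$-th root of $1$. Then: (1) If $r=0$, then $C_n^k(a,b)$ is LCD if and only if $$a/b\notin\left\{-\mu^j/b+\theta^i+\theta^{-i}:\ 1\le i\le\tfrac n2,\ 1\le j\le k'\right\},$$ where $\theta$ is a primitive $(n+1)$-th root of $1$. (2) If $r\ge1$ and $m\ge1$, then $C_n^k(a,b)$ is LCD if and only if $$a/b\notin\{-\mu^j/b:\ 1\le j\le k'\}\cup\left\{-\mu^j/b+\theta^i+\theta^{-i}:\ 1\le i\le\tfrac m2,\ 1\le j\le k'\right\},$$ where $\theta$ is a primitive $(m+1)$-th root of $1$. (3) If $r\ge1$ and $m=0$, then $C_n^k(a,b)$ is LCD if and only if $a\notin\{\mu^j:\ 1\le j\le k'\}$.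
   Context: $T_n(a,b,b)$ denotes the $n\times n$ tridiagonal Toeplitz matrix with all diagonal entries equal to $a$, all subdiagonal and superdiagonal entries equal to $b$, and all other entries $0$; $T_n(a,b,b)^k$ is its $k$-th matrix power. $I_n$ is the identity matrix. Roots of unity are taken in an algebraic closure of $\mathbb{F}_q$. A linear code $C\subseteq\mathbb{F}_q^N$ is LCD if $C\cap C^{\perp}=\{0\}$, where $C^{\perp}=\{y\in\mathbb{F}_q^N:\sum_i x_iy_i=0\text{ for all }x\in C\}$ is the Euclidean dual. The code with generator matrix $G$ is the row space of $G$. *)

theory Defs
  imports
    "Jordan_Normal_Form.VS_Connect"
    "HOL-Algebra.Algebraic_Closure_Type"
begin

text \<open>Subdiagonal entries are \<open>b\<close>, superdiagonal entries are \<open>c\<close>.\<close>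

definition tridiag_toeplitz :: "nat \<Rightarrow> 'a::zero \<Rightarrow> 'a \<Rightarrow> 'a \<Rightarrow> 'a mat" where
  "tridiag_toeplitz n a b c =
     mat n n (\<lambda>(i, j). if i = j then a else if i = j + 1 then b else if j = i + 1 then c else 0)"

definition append_cols :: "'a::zero mat \<Rightarrow> 'a mat \<Rightarrow> 'a mat" (infixr "@\<^sub>c" 65) where
  "A @\<^sub>c B = (A\<^sup>T @\<^sub>r B\<^sup>T)\<^sup>T"

definition code_of_generator :: "'a::field mat \<Rightarrow> 'a vec set" where
  "code_of_generator G = vec_space.row_space (dim_col G) G"

definition euclidean_dual :: "nat \<Rightarrow> 'a::field vec set \<Rightarrow> 'a vec set" where
  "euclidean_dual N C = {y \<in> carrier_vec N. \<forall>x\<in>C. x \<bullet> y = 0}"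

definition is_LCD :: "nat \<Rightarrow> 'a::field vec set \<Rightarrow> bool" where
  "is_LCD N C \<longleftrightarrow> C \<inter> euclidean_dual N C = {0\<^sub>v N}"

definition toeplitz_code :: "nat \<Rightarrow> nat \<Rightarrow> 'a::field \<Rightarrow> 'a \<Rightarrow> 'a vec set" where
  "toeplitz_code n k a b =
     code_of_generator (1\<^sub>m n @\<^sub>c (tridiag_toeplitz n a b b ^\<^sub>m k))"

definition primitive_root_of_unity :: "nat \<Rightarrow> 'a::field \<Rightarrow> bool" where
  "primitive_root_of_unity d x \<longleftrightarrow> d > 0 \<and> x ^ d = 1 \<and> (\<forall>e\<in>{1..<d}. x ^ e \<noteq> 1)"

end

(* A vector x G of the code, G = (I A), is orthogonal to the code iff x (I + A A^T) = 0, so the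
   code is LCD iff I + A A^T is invertible.  For A = T^k with T symmetric this matrix is I + T^(2k),
   which in characteristic 2 is the power of I + T^k' with exponent 2^(t+1).  As k' is odd,
   I + T^k' is singular iff some mu^j is an eigenvalue of T.  The eigenvalues of T are a + b x for
   the roots x of a Chebyshev-type polynomial; with x = z + 1/z and z different from 1, being a root
   means z^(2(n+1)) = 1, that is z^(m+1) = 1 in characteristic 2.  The remaining case z = 1 is
   x = 0, which is a root iff n + 1 is even. *)

theory Submission
  imports Defs "Jordan_Normal_Form.Char_Poly" "HOL-Number_Theory.Residues"
begin

unbundle no fps_syntax

section \<open>Roots of unity\<close>

lemma primitive_root_power_inj:
  assumes "primitive_root_of_unity d x" "x ^ i = x ^ j" "i < d" "j < d"
  shows "i = j"
proof -
  have x: "x \<noteq> 0"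
    using assms(1) by (auto simp: primitive_root_of_unity_def power_0_left split: if_splits)
  have aux: "i = j" if "x ^ i = x ^ j" "i \<le> j" "j < d" for i j
  proof (rule ccontr)
    assume "i \<noteq> j"
    have "x ^ i * x ^ (j - i) = x ^ i * 1"
      using that power_add[of x i "j - i"] by simp
    then have "x ^ (j - i) = 1"
      using x by simp
    moreover have "j - i \<in> {1..<d}"
      using \<open>i \<noteq> j\<close> that by auto
    ultimately show False
      using assms(1) unfolding primitive_root_of_unity_def by blast
  qed
  show ?thesis
    using aux[of i j] aux[of j i] assms(2-4) by (metis nle_le)
qed

text \<open>The \<open>d\<close> powers \<open>x ^ i\<close> with \<open>i < d\<close> are distinct
  roots of X^d - 1, which has at most \<open>d\<close> roots, so they exhaust them.\<close>

lemma root_of_unity_eq_power_primitive_root: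
  fixes x z :: "'a::field"
  assumes x: "primitive_root_of_unity d x" and z: "z ^ d = 1"
  obtains i where "i < d" "z = x ^ i"
proof -
  define p :: "'a poly" where "p = Polynomial.monom 1 d - 1"
  have d: "d > 0" and xd: "x ^ d = 1"
    using x by (auto simp: primitive_root_of_unity_def)
  have poly_p: "poly p y = y ^ d - 1" for y
    by (simp add: p_def poly_monom)
  have "p \<noteq> 0"
    using poly_p[of 0] d by (auto simp: power_0_left)
  moreover have "Polynomial.degree p \<le> d"
    unfolding p_def by (rule degree_diff_le) (auto simp: degree_monom_eq)
  ultimately have card: "card {y. poly p y = 0} \<le> d" and fin: "finite {y. poly p y = 0}"
    using card_poly_roots_bound[of p] poly_roots_finite[of p] by auto
  have "x ^ i \<in> {y. poly p y = 0}" for i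
    using xd by (simp add: poly_p flip: power_mult) (simp add: mult.commute[of i] power_mult)
  then have sub: "(\<lambda>i. x ^ i) ` {..<d} \<subseteq> {y. poly p y = 0}"
    by blast
  have "inj_on (\<lambda>i. x ^ i) {..<d}"
    using primitive_root_power_inj[OF x] by (auto intro!: inj_onI)
  then have "card ((\<lambda>i. x ^ i) ` {..<d}) = d"
    by (simp add: card_image)
  with card have "(\<lambda>i. x ^ i) ` {..<d} = {y. poly p y = 0}"
    using card_seteq[OF fin sub] by simp
  moreover have "z \<in> {y. poly p y = 0}"
    using z by (simp add: poly_p)
  ultimately have "z \<in> (\<lambda>i. x ^ i) ` {..<d}"
    by simp
  then show thesis
    using that by blast
qed

text \<open>Freshman's dream: x^(2^s) - 1 is (x - 1)^(2^s), and a field has no nilpotents.\<close>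

lemma power_two_power_eq_1_iff:
  fixes x :: "'a::field"
  assumes "CHAR('a) = 2"
  shows "x ^ (2 ^ s) = 1 \<longleftrightarrow> x = 1"
proof -
  have "(x - 1) ^ (2 ^ s) = x ^ (2 ^ s) - 1"
    using freshmans_dream'[of "2 ^ s" s x 1] assms by (simp add: minus_CHAR_2)
  then show ?thesis
    by (metis eq_iff_diff_eq_0 power_eq_0_iff zero_less_numeral zero_less_power)
qed

section \<open>Powers of matrices\<close>

lemma pow_mat_add:
  assumes "A \<in> carrier_mat n n"
  shows "A ^\<^sub>m (i + j) = A ^\<^sub>m i * A ^\<^sub>m j"
proof (induction j)
  case 0
  show ?case
    using assms by simp
next
  case (Suc j)
  then show ?case
    using assms by (simp add: assoc_mult_mat[of _ n n _ n _ n])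
qed

lemma transpose_pow_mat:
  fixes A :: "'a::comm_semiring_1 mat"
  assumes A: "A \<in> carrier_mat n n"
  shows "(A ^\<^sub>m k)\<^sup>T = A\<^sup>T ^\<^sub>m k"
proof (induction k)
  case 0
  show ?case
    using A by simp
next
  case (Suc k)
  have "(A ^\<^sub>m Suc k)\<^sup>T = A\<^sup>T * A\<^sup>T ^\<^sub>m k"
    using A Suc by (simp add: transpose_mult[of _ n n _ n])
  also have "\<dots> = A\<^sup>T ^\<^sub>m (1 + k)"
    using A by (subst pow_mat_add[of _ n]) auto
  finally show ?case
    by simp
qed

lemma (in semiring_hom) map_mat_pow:
  assumes "A \<in> carrier_mat n n"
  shows "map_mat hom (A ^\<^sub>m k) = map_mat hom A ^\<^sub>m k"
  using assms by (induction k) (auto simp: mat_hom_mult[of _ n n _ n] mat_hom_one)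

text \<open>Squaring I + B gives I + B^2, since the cross terms B + B cancel in characteristic 2.
  Each induction step thus doubles the exponent of \<open>A\<close> and squares the
  determinant.\<close>

lemma det_one_plus_pow_mat_two_power:
  fixes A :: "'a::field mat"
  assumes "CHAR('a) = 2" and A: "A \<in> carrier_mat n n"
  shows "det (1\<^sub>m n + A ^\<^sub>m (2 ^ s * k)) = det (1\<^sub>m n + A ^\<^sub>m k) ^ (2 ^ s)"
proof (induction s)
  case (Suc s)
  define B where "B = A ^\<^sub>m (2 ^ s * k)"
  have B: "B \<in> carrier_mat n n"
    using A by (simp add: B_def)
  have double: "x + x = 0" for x :: 'a
    using minus_CHAR_2[OF assms(1), of x x] by simp
  have "(1\<^sub>m n + B) * (1\<^sub>m n + B) = (1\<^sub>m n + B) + (B + B * B)"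
    using B by (simp add: add_mult_distrib_mat[of _ n n _ _ n] mult_add_distrib_mat[of _ n n _ n])
  also have "\<dots> = 1\<^sub>m n + B * B"
    using B double by (intro eq_matI) (auto simp flip: add.assoc simp: add.assoc[of _ "B $$ _" "B $$ _"])
  also have "B * B = A ^\<^sub>m (2 ^ Suc s * k)"
    using A by (simp add: B_def pow_mat_add[of _ n, symmetric] mult_2 algebra_simps)
  finally have "det (1\<^sub>m n + A ^\<^sub>m (2 ^ Suc s * k)) = det (1\<^sub>m n + B) * det (1\<^sub>m n + B)"
    using B by (metis add_carrier_mat det_mult one_carrier_mat)
  also have "\<dots> = det (1\<^sub>m n + A ^\<^sub>m k) ^ (2 ^ Suc s)"
    using Suc by (simp add: B_def power_mult power2_eq_square mult.commute[of 2])
  finally show ?case .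
qed simp

text \<open>If \<open>A ^ k\<close> fixes \<open>v\<close>, then the discrete Fourier transform of the orbit of \<open>v\<close> under \<open>A\<close>
  splits \<open>of_nat k\<close> times \<open>v\<close> into eigenvectors of \<open>A\<close> (or zero) for the eigenvalues \<open>\<mu> ^ j\<close>.\<close>

lemma eigenvalue_pow_mat_1_iff:
  fixes A :: "'a::field mat"
  assumes A: "A \<in> carrier_mat n n" and mu: "primitive_root_of_unity k \<mu>" and k: "of_nat k \<noteq> (0::'a)"
  shows "eigenvalue (A ^\<^sub>m k) 1 \<longleftrightarrow> (\<exists>j\<in>{1..k}. eigenvalue A (\<mu> ^ j))"
proof
  assume "\<exists>j\<in>{1..k}. eigenvalue A (\<mu> ^ j)"
  then obtain j v where v: "eigenvector A v (\<mu> ^ j)"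
    by (auto simp: eigenvalue_def)
  have "(\<mu> ^ j) ^ k = 1"
    using mu by (metis mult.commute power_mult power_one primitive_root_of_unity_def)
  then have "eigenvector (A ^\<^sub>m k) v 1"
    using eigenvector_pow[OF A v, of k] v A by (auto simp: eigenvector_def)
  then show "eigenvalue (A ^\<^sub>m k) 1"
    by (auto simp: eigenvalue_def)
next
  assume "eigenvalue (A ^\<^sub>m k) 1"
  then obtain v where v: "v \<in> carrier_vec n" "v \<noteq> 0\<^sub>v n" and fixed: "A ^\<^sub>m k *\<^sub>v v = v"
    using A by (auto simp: eigenvalue_def eigenvector_def)
  have k0: "k > 0" and mu1: "\<mu> ^ k = 1"
    using mu by (auto simp: primitive_root_of_unity_def)
  have mu0: "\<mu> \<noteq> 0"
    using mu1 k0 by (auto simp: power_0_left)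
  \<comment> \<open>The orbit of \<open>v\<close> under \<open>A\<close>; it closes up after
    \<open>k\<close> steps because \<open>A ^\<^sub>m k\<close> fixes \<open>v\<close>.\<close>
  define x where "x i = A ^\<^sub>m i *\<^sub>v v" for i
  have x_carrier: "x i \<in> carrier_vec n" for i
    using mult_mat_vec_carrier[OF pow_carrier_mat[OF A] v(1)] by (simp add: x_def)
  have x_k: "x k = x 0"
    using fixed A v by (simp add: x_def)
  have x_Suc: "A *\<^sub>v x i = x (Suc i)" for i
  proof -
    have "A ^\<^sub>m Suc i = A * A ^\<^sub>m i"
      using pow_mat_add[OF A, of 1 i] A by simp
    then show ?thesis
      using A v by (simp add: x_def assoc_mult_mat_vec[of _ n n _ n])
  qed
  have x_Suc_nth: "(\<Sum>c<n. A $$ (l, c) * x i $ c) = x (Suc i) $ l" if "l < n" for i l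
    using that A x_carrier[of i] unfolding x_Suc[symmetric]
    by (auto simp: scalar_prod_def atLeast0LessThan intro!: sum.cong)
  \<comment> \<open>With these weights, applying \<open>A\<close> shifts the orbit by one place and
    so multiplies the sum by \<open>\<mu> ^ j\<close>.\<close>
  define w where "w j = vec n (\<lambda>l. \<Sum>i<k. inverse (\<mu> ^ j) ^ i * x i $ l)" for j
  have Aw: "A *\<^sub>v w j = \<mu> ^ j \<cdot>\<^sub>v w j" for j
  proof (rule eq_vecI)
    fix l
    assume "l < dim_vec (\<mu> ^ j \<cdot>\<^sub>v w j)"
    then have l: "l < n"
      by (simp add: w_def)
    define \<omega> where "\<omega> = inverse (\<mu> ^ j)"
    have \<omega>k: "\<omega> ^ k = 1"
      using mu1 by (metis \<omega>_def inverse_1 mult.commute power_inverse power_mult power_one)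
    have \<omega>0: "\<mu> ^ j * \<omega> = 1"
      using mu0 by (simp add: \<omega>_def)
    \<comment> \<open>The shift is cyclic: the term at \<open>k\<close> equals the term at 0, as
      \<open>\<omega> ^ k = 1\<close> and \<open>x k = x 0\<close>.\<close>
    have shift: "(\<Sum>i<k. \<omega> ^ Suc i * x (Suc i) $ l) = (\<Sum>i<k. \<omega> ^ i * x i $ l)"
      using sum.lessThan_Suc_shift[of "\<lambda>i. \<omega> ^ i * x i $ l" k]
      by (simp add: \<omega>k x_k)
    have "(A *\<^sub>v w j) $ l = (\<Sum>c<n. A $$ (l, c) * (\<Sum>i<k. \<omega> ^ i * x i $ c))"
      using A l by (auto simp: scalar_prod_def w_def \<omega>_def atLeast0LessThan intro!: sum.cong)
    also have "\<dots> = (\<Sum>i<k. \<omega> ^ i * (\<Sum>c<n. A $$ (l, c) * x i $ c))"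
      unfolding sum_distrib_left by (subst sum.swap) (simp add: mult_ac)
    also have "\<dots> = (\<Sum>i<k. \<omega> ^ i * x (Suc i) $ l)"
      using l by (simp add: x_Suc_nth)
    also have "\<dots> = (\<Sum>i<k. \<mu> ^ j * (\<omega> ^ Suc i * x (Suc i) $ l))"
      using \<omega>0 by (simp flip: mult.assoc)
    also have "\<dots> = \<mu> ^ j * (\<Sum>i<k. \<omega> ^ i * x i $ l)"
      by (simp only: shift flip: sum_distrib_left)
    finally show "(A *\<^sub>v w j) $ l = (\<mu> ^ j \<cdot>\<^sub>v w j) $ l"
      using l by (simp add: w_def \<omega>_def)
  qed (use A in \<open>simp add: w_def\<close>)
  have "\<exists>j\<in>{1..k}. w j \<noteq> 0\<^sub>v n"
  proof (rule ccontr)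
    assume "\<not> (\<exists>j\<in>{1..k}. w j \<noteq> 0\<^sub>v n)"
    then have w0: "w j = 0\<^sub>v n" if "j \<in> {1..k}" for j
      using that by blast
    \<comment> \<open>Orthogonality of characters: a geometric sum over a full period, whose ratio
      differs from 1 because \<open>\<mu>\<close> is primitive and 0 < i < k.\<close>
    have geo: "(\<Sum>j = 1..k. inverse (\<mu> ^ j) ^ i) = 0" if "i \<in> {..<k} - {0}" for i
    proof -
      define \<omega> where "\<omega> = inverse (\<mu> ^ i)"
      have \<omega>k: "\<omega> ^ k = 1"
        using mu1 by (metis \<omega>_def inverse_1 mult.commute power_inverse power_mult power_one)
      have "\<omega> \<noteq> 1"
        using mu that by (auto simp: \<omega>_def primitive_root_of_unity_def)
      have "(\<Sum>j = 1..k. inverse (\<mu> ^ j) ^ i) = (\<Sum>j = 1..k. \<omega> ^ j)"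
        by (simp add: \<omega>_def power_inverse mult.commute flip: power_mult)
      also have "\<dots> = (\<Sum>j<k. \<omega> ^ Suc j)"
        by (rule sum.reindex_bij_witness[of _ Suc "\<lambda>j. j - 1"]) auto
      also have "\<dots> = \<omega> * (\<Sum>j<k. \<omega> ^ j)"
        by (simp add: sum_distrib_left)
      also have "(\<Sum>j<k. \<omega> ^ j) = 0"
        using sum_gp_strict[of \<omega> k] \<open>\<omega> \<noteq> 1\<close> \<omega>k by simp
      finally show ?thesis
        by simp
    qed
    have "v $ l = 0" if l: "l < n" for l
    proof -
      have "0 = (\<Sum>j = 1..k. w j $ l)"
        using w0 l by simp
      also have "\<dots> = (\<Sum>i<k. (\<Sum>j = 1..k. inverse (\<mu> ^ j) ^ i) * x i $ l)"
        using l unfolding sum_distrib_right by (subst sum.swap) (simp add: w_def)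
      \<comment> \<open>Only \<open>i = 0\<close> survives and contributes \<open>k\<close> copies
        of \<open>v\<close>; since \<open>of_nat k\<close> is nonzero, this forces \<open>v\<close>
        to vanish.\<close>
      also have "\<dots> = (\<Sum>i\<in>{0}. (\<Sum>j = 1..k. inverse (\<mu> ^ j) ^ i) * x i $ l)"
        using geo k0 by (intro sum.mono_neutral_right) auto
      also have "\<dots> = of_nat k * v $ l"
        using A v by (simp add: x_def)
      finally show ?thesis
        using k by simp
    qed
    then have "v = 0\<^sub>v n"
      using v(1) by (intro eq_vecI) auto
    with v(2) show False ..
  qed
  then obtain j where j: "j \<in> {1..k}" "w j \<noteq> 0\<^sub>v n" ..
  then have "eigenvector A (w j) (\<mu> ^ j)"
    using A Aw[of j] by (simp add: eigenvector_def w_def)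
  with j show "\<exists>j\<in>{1..k}. eigenvalue A (\<mu> ^ j)"
    by (auto simp: eigenvalue_def)
qed

section \<open>Codes with a systematic generator matrix\<close>

text \<open>The map \<open>f\<close> encodes a message \<open>y\<close>; it is injective because
  \<open>y\<close> is the first block of \<open>f y\<close>. Pulling the inner product back along
  \<open>f\<close> gives the bilinear form of \<open>M\<close>, so the intersection of the code with
  its dual is the image under \<open>f\<close> of the kernel of \<open>M\<close>.\<close>

lemma is_LCD_systematic_iff:
  fixes A :: "'a::field mat"
  assumes A: "A \<in> carrier_mat n m"
  shows "is_LCD (n + m) (code_of_generator (1\<^sub>m n @\<^sub>c A)) \<longleftrightarrow> det (1\<^sub>m n + A * A\<^sup>T) \<noteq> 0"
proof -
  define f where "f y = y @\<^sub>v (A\<^sup>T *\<^sub>v y)" for y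
  define M where "M = 1\<^sub>m n + A * A\<^sup>T"
  have M: "M \<in> carrier_mat n n"
    using A by (simp add: M_def)
  define G where "G = 1\<^sub>m n @\<^sub>c A"
  have GT: "G\<^sup>T = 1\<^sub>m n @\<^sub>r A\<^sup>T"
    by (simp add: G_def append_cols_def)
  have "1\<^sub>m n @\<^sub>r A\<^sup>T \<in> carrier_mat (n + m) n"
    using A by auto
  then have G: "G \<in> carrier_mat n (n + m)"
    by (simp flip: GT)
  have f_carrier: "f y \<in> carrier_vec (n + m)" if "y \<in> carrier_vec n" for y
    using that A unfolding f_def by (intro append_carrier_vec) auto
  have G_f: "G\<^sup>T *\<^sub>v y = f y" if "y \<in> carrier_vec n" for y
    using A that unfolding GT f_def by (subst mat_mult_append[of _ n n _ m]) auto
  have code: "code_of_generator G = f ` carrier_vec n"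
    using G_f f_carrier G vec_space.row_space_eq[OF G]
    by (auto simp: code_of_generator_def image_iff)
  have f_scalar: "f x \<bullet> f y = x \<bullet> (M *\<^sub>v y)" if x: "x \<in> carrier_vec n" and y: "y \<in> carrier_vec n" for x y
  proof -
    have "f x \<bullet> f y = x \<bullet> y + (A\<^sup>T *\<^sub>v x) \<bullet> (A\<^sup>T *\<^sub>v y)"
      unfolding f_def using x y A by (intro scalar_prod_append[of _ n _ m]) auto
    also have "(A\<^sup>T *\<^sub>v x) \<bullet> (A\<^sup>T *\<^sub>v y) = x \<bullet> (A *\<^sub>v (A\<^sup>T *\<^sub>v y))"
      using A x y by (intro transpose_vec_mult_scalar) auto
    also have "x \<bullet> y + \<dots> = x \<bullet> (M *\<^sub>v y)"
      using A x y by (simp add: M_def add_mult_distrib_mat_vec[of _ n n] assoc_mult_mat_vec[of _ n m _ n]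
          scalar_prod_add_distrib[of _ n])
    finally show ?thesis .
  qed
  have orth: "(\<forall>x\<in>carrier_vec n. f x \<bullet> f y = 0) \<longleftrightarrow> M *\<^sub>v y = 0\<^sub>v n" if y: "y \<in> carrier_vec n" for y
  proof
    assume *: "\<forall>x\<in>carrier_vec n. f x \<bullet> f y = 0"
    show "M *\<^sub>v y = 0\<^sub>v n"
    proof (rule eq_vecI)
      fix i
      assume "i < dim_vec (0\<^sub>v n :: 'a vec)"
      then have i: "i < n"
        by simp
      \<comment> \<open>Testing against the codeword of a unit vector reads off one coordinate of
        \<open>M *\<^sub>v y\<close>.\<close>
      have "f (unit_vec n i) \<bullet> f y = unit_vec n i \<bullet> (M *\<^sub>v y)"
        using y by (simp add: f_scalar)
      also have "\<dots> = (M *\<^sub>v y) $ i"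
        using i M y by (intro scalar_prod_left_unit) auto
      finally show "(M *\<^sub>v y) $ i = 0\<^sub>v n $ i"
        using * i by simp
    qed (use M in simp)
  qed (use y in \<open>simp add: f_scalar\<close>)
  have f_0: "f y = 0\<^sub>v (n + m) \<longleftrightarrow> y = 0\<^sub>v n" if "y \<in> carrier_vec n" for y
  proof -
    have "0\<^sub>v (n + m) = 0\<^sub>v n @\<^sub>v (0\<^sub>v m :: 'a vec)"
      by (intro eq_vecI) auto
    then have "f y = 0\<^sub>v (n + m) \<longleftrightarrow> y = 0\<^sub>v n \<and> A\<^sup>T *\<^sub>v y = 0\<^sub>v m"
      using that unfolding f_def by (simp add: append_vec_eq[of _ n])
    also have "\<dots> \<longleftrightarrow> y = 0\<^sub>v n"
      using A by auto
    finally show ?thesis .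
  qed
  have hull: "code_of_generator G \<inter> euclidean_dual (n + m) (code_of_generator G)
      = f ` {y \<in> carrier_vec n. M *\<^sub>v y = 0\<^sub>v n}"
    using f_carrier orth by (auto simp: code euclidean_dual_def)
  \<comment> \<open>The kernel is nonempty; otherwise its image could be empty instead of a
    singleton.\<close>
  have "0\<^sub>v n \<in> {y \<in> carrier_vec n. M *\<^sub>v y = 0\<^sub>v n}"
    using M by auto
  then have image_eq: "f ` {y \<in> carrier_vec n. M *\<^sub>v y = 0\<^sub>v n} = {c} \<longleftrightarrow>
      (\<forall>y\<in>{y \<in> carrier_vec n. M *\<^sub>v y = 0\<^sub>v n}. f y = c)" for c
    by (auto simp: image_constant_conv intro!: exI[of _ "0\<^sub>v n"])
  have "is_LCD (n + m) (code_of_generator G) \<longleftrightarrow> (\<forall>y\<in>carrier_vec n. M *\<^sub>v y = 0\<^sub>v n \<longrightarrow> y = 0\<^sub>v n)"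
    unfolding is_LCD_def hull image_eq using f_0 by auto
  also have "\<dots> \<longleftrightarrow> det M \<noteq> 0"
    unfolding det_0_iff_vec_prod_zero[OF M] by blast
  finally show ?thesis
    by (simp add: G_def M_def)
qed

section \<open>Eigenvalues of symmetric tridiagonal Toeplitz matrices\<close>

text \<open>Chebyshev polynomials of the second kind, rescaled and indexed such that
  \<open>cheb (Suc n)\<close> is the characteristic polynomial of the path on \<open>n\<close> vertices.\<close>

fun cheb :: "nat \<Rightarrow> 'a::comm_ring_1 \<Rightarrow> 'a" where
  "cheb 0 x = 0"
| "cheb (Suc 0) x = 1"
| "cheb (Suc (Suc n)) x = x * cheb (Suc n) x - cheb n x"

text \<open>The formula sin(nt)/sin(t) with z in place of exp(it). Both z^n and z^(-n) satisfy the
  recurrence. Multiplying by z - 1/z avoids a division that fails when z^2 = 1.\<close>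

lemma cheb_add_inverse:
  fixes z :: "'a::field"
  assumes "z \<noteq> 0"
  shows "cheb n (z + inverse z) * (z - inverse z) = z ^ n - inverse z ^ n"
proof (induction n "z + inverse z" rule: cheb.induct)
  case (3 n)
  let ?x = "z + inverse z"
  have "cheb (Suc (Suc n)) ?x * (z - inverse z)
      = ?x * (cheb (Suc n) ?x * (z - inverse z)) - cheb n ?x * (z - inverse z)"
    by (simp add: algebra_simps)
  also have "\<dots> = ?x * (z ^ Suc n - inverse z ^ Suc n) - (z ^ n - inverse z ^ n)"
    by (simp only: 3)
  also have "\<dots> = z ^ Suc (Suc n) - inverse z ^ Suc (Suc n)
      + (z * inverse z - 1) * (z ^ n - inverse z ^ n)"
    by (simp add: algebra_simps)
  finally show ?case
    using assms by simp
qed simp_all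

text \<open>Covers z = 1, where the previous identity reads 0 = 0. In characteristic 2 the argument
  2 is 0.\<close>

lemma cheb_2: "cheb n (2 :: 'a::comm_ring_1) = of_nat n"
  by (induction n "2 :: 'a" rule: cheb.induct) (simp_all add: algebra_simps)

lemma tridiag_toeplitz_carrier [simp]: "tridiag_toeplitz n a b c \<in> carrier_mat n n"
  by (simp add: tridiag_toeplitz_def)

lemma dim_tridiag_toeplitz [simp]:
  "dim_row (tridiag_toeplitz n a b c) = n" "dim_col (tridiag_toeplitz n a b c) = n"
  by (simp_all add: tridiag_toeplitz_def)

lemma transpose_tridiag_toeplitz: "(tridiag_toeplitz n a b c)\<^sup>T = tridiag_toeplitz n a c b"
  by (rule eq_matI) (auto simp: tridiag_toeplitz_def)

lemma tridiag_toeplitz_mult_vec_nth: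
  fixes a b c :: "'a::comm_ring_1"
  assumes v: "v \<in> carrier_vec n" and i: "i < n"
  shows "(tridiag_toeplitz n a b c *\<^sub>v v) $ i =
    a * v $ i + (if i = 0 then 0 else b * v $ (i - 1)) + (if Suc i < n then c * v $ Suc i else 0)"
proof -
  have "(tridiag_toeplitz n a b c *\<^sub>v v) $ i =
      (\<Sum>j<n. (if i = j then a else if i = j + 1 then b else if j = i + 1 then c else 0) * v $ j)"
    using v i by (auto simp: scalar_prod_def tridiag_toeplitz_def atLeast0LessThan intro!: sum.cong)
  \<comment> \<open>Each summand is supported at a single \<open>j\<close>. For \<open>i = 0\<close>
    the truncated \<open>i - 1\<close> is 0, so the inner test has to discard that term.\<close>
  also have "\<dots> = (\<Sum>j<n. (if j = i then a * v $ i else 0)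
      + (if j = i - 1 then if i = 0 then 0 else b * v $ (i - 1) else 0)
      + (if j = Suc i then c * v $ Suc i else 0))"
    by (intro sum.cong) auto
  also have "\<dots> = a * v $ i + (if i = 0 then 0 else b * v $ (i - 1))
      + (if Suc i < n then c * v $ Suc i else 0)"
    using i by (auto simp: sum.distrib sum.delta)
  finally show ?thesis .
qed

text \<open>Row by row, the eigenvector equation is the three-term recurrence of \<open>cheb\<close>
  at the rescaled eigenvalue. The boundary value 0 on the left makes the entries a multiple of
  \<open>cheb\<close>; the boundary value 0 on the right is the stated equation.\<close>

lemma eigenvalue_tridiag_toeplitz_iff:
  fixes a b e :: "'a::field"
  assumes b: "b \<noteq> 0" and n: "n > 0"
  shows "eigenvalue (tridiag_toeplitz n a b b) e \<longleftrightarrow> cheb (Suc n) ((e - a) / b) = 0"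
proof -
  let ?T = "tridiag_toeplitz n a b b"
  define x where "x = (e - a) / b"
  have e: "e = a + b * x"
    using b by (simp add: x_def)
  \<comment> \<open>One row with centre \<open>p\<close>, left neighbour \<open>q\<close> and right
    neighbour \<open>r\<close>, solved for \<open>r\<close>.\<close>
  have eq_iff: "a * p + b * q + b * r = e * p \<longleftrightarrow> r = x * p - q" for p q r
  proof -
    have "a * p + b * q + b * r = e * p \<longleftrightarrow> b * (q + r) = b * (x * p)"
      by (auto simp: e algebra_simps)
    also have "\<dots> \<longleftrightarrow> q + r = x * p"
      using b by simp
    also have "\<dots> \<longleftrightarrow> r = x * p - q"
      by (auto simp: algebra_simps)
    finally show ?thesis .
  qed
  show ?thesis
    unfolding x_def[symmetric]
  proof
    assume "eigenvalue ?T e"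
    then obtain v where v: "v \<in> carrier_vec n" "v \<noteq> 0\<^sub>v n" and Tv: "?T *\<^sub>v v = e \<cdot>\<^sub>v v"
      by (auto simp: eigenvalue_def eigenvector_def tridiag_toeplitz_def)
    \<comment> \<open>The entries of \<open>v\<close> shifted by one and padded with 0 at the
      indices 0 and n + 1, so that the first and last rows need no special treatment.\<close>
    define u where "u i = (if i = 0 \<or> n < i then 0 else v $ (i - 1))" for i
    have rec: "u (Suc (Suc i)) = x * u (Suc i) - u i" if i: "i < n" for i
    proof -
      have "(?T *\<^sub>v v) $ i = a * u (Suc i) + b * u i + b * u (Suc (Suc i))"
        using i v by (simp add: tridiag_toeplitz_mult_vec_nth u_def del: index_mult_mat_vec)
      moreover have "(e \<cdot>\<^sub>v v) $ i = e * u (Suc i)"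
        using i v by (simp add: u_def)
      ultimately show ?thesis
        using Tv by (simp flip: eq_iff)
    qed
    have u: "u i = u 1 * cheb i x" if "i \<le> Suc n" for i
      using that
    proof (induction i rule: induct_nat_012)
      case (ge2 i)
      then show ?case
        using rec[of i] by (simp add: algebra_simps)
    qed (simp_all add: u_def)
    have "u 1 \<noteq> 0"
    proof
      assume 0: "u 1 = 0"
      have "v $ i = 0" if "i < n" for i
        using u[of "Suc i"] that 0 by (simp add: u_def)
      then have "v = 0\<^sub>v n"
        using v(1) by (intro eq_vecI) auto
      with v(2) show False ..
    qed
    then show "cheb (Suc n) x = 0"
      using u[of "Suc n"] by (simp add: u_def)
  next
    assume 0: "cheb (Suc n) x = 0"
    define v where "v = vec n (\<lambda>i. cheb (Suc i) x)"
    have v: "v \<in> carrier_vec n"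
      by (simp add: v_def)
    have "v $ 0 = 1"
      using n by (simp add: v_def)
    then have "v \<noteq> 0\<^sub>v n"
      using n by auto
    moreover have "?T *\<^sub>v v = e \<cdot>\<^sub>v v"
    proof (rule eq_vecI)
      fix i
      assume "i < dim_vec (e \<cdot>\<^sub>v v)"
      then have i: "i < n"
        by (simp add: v_def)
      \<comment> \<open>In the last row the missing right neighbour is
        \<open>cheb (Suc n) x\<close>, which is 0 by assumption.\<close>
      have 1: "(if Suc i < n then b * v $ Suc i else 0) = b * cheb (Suc (Suc i)) x"
      proof (cases "Suc i < n")
        case False
        then have "Suc i = n"
          using i by simp
        then show ?thesis
          using 0 by (simp del: cheb.simps)
      qed (simp add: v_def)
      \<comment> \<open>In the first row the missing left neighbour is \<open>cheb 0 x\<close>,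
        which is 0.\<close>
      have 2: "(if i = 0 then 0 else b * v $ (i - 1)) = b * cheb i x"
        using i by (cases i) (auto simp: v_def)
      have "(?T *\<^sub>v v) $ i = a * cheb (Suc i) x + b * cheb i x + b * cheb (Suc (Suc i)) x"
        unfolding tridiag_toeplitz_mult_vec_nth[OF v i] 1 2 using i by (simp add: v_def)
      also have "\<dots> = e * cheb (Suc i) x"
        by (subst eq_iff) simp
      finally show "(?T *\<^sub>v v) $ i = (e \<cdot>\<^sub>v v) $ i"
        using i by (simp add: v_def)
    qed (simp add: v_def tridiag_toeplitz_def)
    ultimately show "eigenvalue ?T e"
      using v by (auto simp: eigenvalue_def eigenvector_def tridiag_toeplitz_def)
  qed
qed

section \<open>Zeros of the Chebyshev polynomials in characteristic 2\<close>

lemma alg_closed_add_inverse_surj: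
  fixes x :: "'a::alg_closed_field"
  obtains z where "z \<noteq> 0" "x = z + inverse z"
proof -
  have "\<exists>z. poly [:1, - x, 1:] z = 0"
    by (rule alg_closed_imp_poly_has_root) simp
  then obtain z where z: "1 - x * z + z * z = 0"
    by (auto simp: algebra_simps)
  then have "z \<noteq> 0"
    by auto
  moreover have "x = z + inverse z"
    using z \<open>z \<noteq> 0\<close> by (simp add: field_simps)
  ultimately show thesis
    by (rule that)
qed

text \<open>Nonzero zeros come from the \<open>d\<close>-th roots of unity other than 1. These pair
  up as \<open>\<theta> ^ i\<close> and \<open>\<theta> ^ (d - i)\<close>, which are mutually
  inverse and give the same \<open>x\<close>; hence the bound \<open>2 * i < d\<close>.\<close>

lemma cheb_eq_0_iff:
  fixes x \<theta> :: "'a::alg_closed_field"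
  assumes char: "CHAR('a) = 2" and N: "N = 2 ^ r * d" and d: "odd d"
    and \<theta>: "primitive_root_of_unity d \<theta>"
  shows "cheb N x = 0 \<longleftrightarrow>
    r \<ge> 1 \<and> x = 0 \<or> (\<exists>i. 1 \<le> i \<and> 2 * i < d \<and> x = \<theta> ^ i + inverse (\<theta> ^ i))"
proof -
  obtain z where z: "z \<noteq> 0" and x: "x = z + inverse z"
    by (rule alg_closed_add_inverse_surj)
  \<comment> \<open>Plus and minus agree in characteristic 2, so the sum vanishes iff y^2 = 1, and 1
    is the only square root of 1.\<close>
  have eq_inverse_iff: "y + inverse y = 0 \<longleftrightarrow> y = 1" if "y \<noteq> 0" for y :: 'a
  proof -
    have "y + inverse y = 0 \<longleftrightarrow> y - inverse y = 0"
      using char by (simp add: minus_CHAR_2)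
    also have "\<dots> \<longleftrightarrow> y ^ (2 ^ 1) = 1"
      using that by (auto simp: field_simps power2_eq_square)
    finally show ?thesis
      using power_two_power_eq_1_iff[OF char, of y 1] by simp
  qed
  have \<theta>d: "\<theta> ^ d = 1" and \<theta>0: "\<theta> \<noteq> 0" and d0: "d > 0"
    using \<theta> by (auto simp: primitive_root_of_unity_def power_0_left split: if_splits)
  have \<theta>_ne_1: "\<theta> ^ i \<noteq> 1" if "1 \<le> i" "i < d" for i
    using \<theta> that by (auto simp: primitive_root_of_unity_def)
  show ?thesis
  proof (cases "z = 1")
    case True
    have two: "(2 :: 'a) = 0"
      using of_nat_CHAR[where ?'a = 'a] char by simp
    have x0: "x = 0"
      using True two by (simp add: x)
    have "cheb N x = of_nat N"
      using cheb_2[of N, where ?'a = 'a] two x0 by simp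
    also have "\<dots> = 0 \<longleftrightarrow> even N"
      by (simp add: of_nat_eq_0_iff_char_dvd char)
    also have "\<dots> \<longleftrightarrow> r \<ge> 1"
      using N d by auto
    \<comment> \<open>The second disjunct fails here: \<open>\<theta> ^ i\<close> is not 1 in that
      range, so its sum with its inverse is nonzero.\<close>
    finally show ?thesis
      using x0 eq_inverse_iff[of "\<theta> ^ i" for i] \<theta>_ne_1 \<theta>0 by (metis add_lessD1 mult_2 power_not_zero)
  next
    case False
    then have x0: "x \<noteq> 0"
      using eq_inverse_iff[OF z] by (simp add: x)
    have "z - inverse z \<noteq> 0"
      using False eq_inverse_iff[OF z] char by (simp add: minus_CHAR_2)
    then have "cheb N x = 0 \<longleftrightarrow> z ^ N - inverse z ^ N = 0"
      by (simp add: x flip: cheb_add_inverse[OF z])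
    also have "\<dots> \<longleftrightarrow> z ^ N = 1"
      using eq_inverse_iff[of "z ^ N"] z char by (simp add: minus_CHAR_2 power_inverse)
    also have "\<dots> \<longleftrightarrow> z ^ d = 1"
      using power_two_power_eq_1_iff[OF char, of "z ^ d" r]
      by (simp add: N mult.commute flip: power_mult)
    also have "\<dots> \<longleftrightarrow> (\<exists>i. 1 \<le> i \<and> 2 * i < d \<and> x = \<theta> ^ i + inverse (\<theta> ^ i))"
    proof
      assume "z ^ d = 1"
      then obtain i where i: "i < d" "z = \<theta> ^ i"
        by (rule root_of_unity_eq_power_primitive_root[OF \<theta>])
      then have i0: "i \<noteq> 0"
        using False by (intro notI) simp
      show "\<exists>i. 1 \<le> i \<and> 2 * i < d \<and> x = \<theta> ^ i + inverse (\<theta> ^ i)"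
      proof (cases "2 * i < d")
        case True
        then show ?thesis
          using i i0 by (intro exI[of _ i]) (simp add: x)
      next
        case False
        \<comment> \<open>In the upper half of the range, pass to the inverse root;
          \<open>2 * i = d\<close> is excluded because \<open>d\<close> is odd.\<close>
        have "\<theta> ^ (d - i) * \<theta> ^ i = 1"
          using i \<theta>d by (simp flip: power_add)
        then have "\<theta> ^ (d - i) = inverse z"
          using i z by (simp add: field_simps)
        moreover have "2 * (d - i) < d"
          using False d i by presburger
        ultimately show ?thesis
          using i by (intro exI[of _ "d - i"]) (simp add: x)
      qed
    next
      assume "\<exists>i. 1 \<le> i \<and> 2 * i < d \<and> x = \<theta> ^ i + inverse (\<theta> ^ i)"
      then obtain i where i: "x = \<theta> ^ i + inverse (\<theta> ^ i)"
        by blast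
      define y where "y = \<theta> ^ i"
      have y: "y \<noteq> 0" "y ^ d = 1"
        using \<theta>0 \<theta>d by (auto simp: y_def mult.commute simp flip: power_mult) (metis power_mult power_one)
      \<comment> \<open>Clearing denominators in z + 1/z = y + 1/y: the sum determines
        \<open>z\<close> up to inversion.\<close>
      have "(z - y) * (z * y - 1) = 0"
        using i z y unfolding x y_def[symmetric] by (simp add: field_simps)
      then have "z = y \<or> y * z = 1"
        by (auto simp: mult.commute)
      then have "z = y \<or> z = inverse y"
        using inverse_unique[of y z] by auto
      then show "z ^ d = 1"
        using y by (auto simp: power_inverse)
    qed
    finally show ?thesis
      using x0 by simp
  qed
qed

section \<open>The LCD criterion for Toeplitz codes, uniformly in \<open>r\<close> and
  \<open>d\<close>\<close>

lemma is_LCD_toeplitz_code_iff: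
  fixes a b :: "'a::{finite,field}" and \<mu> \<theta> :: "'a alg_closure"
  assumes char: "CHAR('a) = 2" and b: "b \<noteq> 0" and n: "n > 0"
    and n_eq: "n + 1 = 2 ^ r * d" and d: "odd d" and k: "k = 2 ^ t * k'" "odd k'"
    and mu: "primitive_root_of_unity k' \<mu>" and \<theta>: "primitive_root_of_unity d \<theta>"
  shows "is_LCD (2 * n) (toeplitz_code n k a b) \<longleftrightarrow>
    \<not> (\<exists>j. 1 \<le> j \<and> j \<le> k' \<and> (r \<ge> 1 \<and> to_ac (a / b) = - (\<mu> ^ j) / to_ac b \<or>
      (\<exists>i. 1 \<le> i \<and> 2 * i < d \<and>
        to_ac (a / b) = - (\<mu> ^ j) / to_ac b + \<theta> powi int i + \<theta> powi (- int i))))"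
proof -
  have char_ac: "CHAR('a alg_closure) = 2"
    using char by simp
  let ?T = "tridiag_toeplitz n a b b"
  let ?T' = "tridiag_toeplitz n (to_ac a) (to_ac b) (to_ac b)"
  interpret ac: field_hom "to_ac :: 'a \<Rightarrow> 'a alg_closure"
    by unfold_locales auto
  have map_T: "map_mat to_ac ?T = ?T'"
    by (rule eq_matI) (auto simp: tridiag_toeplitz_def)
  have neg: "- y = y" for y :: "'a alg_closure"
    using char_ac by (rule uminus_CHAR_2)
  have pow: "?T ^\<^sub>m j \<in> carrier_mat n n" "?T' ^\<^sub>m j \<in> carrier_mat n n" for j
    by simp_all
  \<comment> \<open>By symmetry the product is \<open>?T ^\<^sub>m (2 * k)\<close>; the factor 2
    turns \<open>t\<close> into \<open>Suc t\<close>.\<close>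
  have "?T ^\<^sub>m k * (?T ^\<^sub>m k)\<^sup>T = ?T ^\<^sub>m (2 ^ Suc t * k')"
    by (simp add: transpose_pow_mat[of _ n] transpose_tridiag_toeplitz pow_mat_add[of _ n, symmetric]
        k(1) mult.assoc flip: mult_2)
  then have "is_LCD (2 * n) (toeplitz_code n k a b) \<longleftrightarrow> det (1\<^sub>m n + ?T ^\<^sub>m (2 ^ Suc t * k')) \<noteq> 0"
    using is_LCD_systematic_iff[OF pow(1)[of k]] by (simp add: toeplitz_code_def mult_2)
  also have "\<dots> \<longleftrightarrow> det (1\<^sub>m n + ?T ^\<^sub>m k') \<noteq> 0"
    by (subst det_one_plus_pow_mat_two_power[OF char]) auto
  \<comment> \<open>Move to the algebraic closure, where \<open>\<mu>\<close> and
    \<open>\<theta>\<close> live.\<close>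
  also have "\<dots> \<longleftrightarrow> to_ac (det (1\<^sub>m n + ?T ^\<^sub>m k')) \<noteq> 0"
    by simp
  also have "to_ac (det (1\<^sub>m n + ?T ^\<^sub>m k')) = det (map_mat to_ac (1\<^sub>m n + ?T ^\<^sub>m k'))"
    by simp
  \<comment> \<open>The characteristic matrix at 1 is A - I, which equals I + A in characteristic
    2.\<close>
  also have "map_mat to_ac (1\<^sub>m n + ?T ^\<^sub>m k') = char_matrix (?T' ^\<^sub>m k') 1"
    unfolding map_T[symmetric] ac.map_mat_pow[OF tridiag_toeplitz_carrier, symmetric]
    using pow(1)[of k'] by (intro eq_matI) (auto simp: char_matrix_def neg add.commute)
  also have "det (char_matrix (?T' ^\<^sub>m k') 1) \<noteq> 0 \<longleftrightarrow> \<not> eigenvalue (?T' ^\<^sub>m k') 1"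
    by (simp add: eigenvalue_det[OF pow(2)])
  also have "\<dots> \<longleftrightarrow> \<not> (\<exists>j\<in>{1..k'}. eigenvalue ?T' (\<mu> ^ j))"
    by (subst eigenvalue_pow_mat_1_iff[OF _ mu]) (use k(2) char_ac in \<open>auto simp: of_nat_eq_0_iff_char_dvd\<close>)
  finally have LCD: "is_LCD (2 * n) (toeplitz_code n k a b) \<longleftrightarrow>
      \<not> (\<exists>j\<in>{1..k'}. eigenvalue ?T' (\<mu> ^ j))" .
  have ev: "eigenvalue ?T' (\<mu> ^ j) \<longleftrightarrow> r \<ge> 1 \<and> to_ac (a / b) = - (\<mu> ^ j) / to_ac b \<or>
      (\<exists>i. 1 \<le> i \<and> 2 * i < d \<and>
        to_ac (a / b) = - (\<mu> ^ j) / to_ac b + \<theta> powi int i + \<theta> powi (- int i))" for j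
  proof -
    have shift: "(\<mu> ^ j - to_ac a) / to_ac b = y \<longleftrightarrow> to_ac (a / b) = - (\<mu> ^ j) / to_ac b + y" for y
    proof -
      have "(\<mu> ^ j - to_ac a) / to_ac b = \<mu> ^ j / to_ac b + to_ac a / to_ac b"
        by (simp add: minus_CHAR_2[OF char_ac] add_divide_distrib)
      then show ?thesis
        by (auto simp: algebra_simps)
    qed
    have powi_eq: "y + \<theta> powi int i + \<theta> powi (- int i) = y + (\<theta> ^ i + inverse (\<theta> ^ i))" for y i
      by (simp add: power_int_minus add.assoc)
    have "eigenvalue ?T' (\<mu> ^ j) \<longleftrightarrow> cheb (n + 1) ((\<mu> ^ j - to_ac a) / to_ac b) = 0"
      using b n by (simp add: eigenvalue_tridiag_toeplitz_iff)
    also have "\<dots> \<longleftrightarrow> r \<ge> 1 \<and> to_ac (a / b) = - (\<mu> ^ j) / to_ac b \<or>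
      (\<exists>i. 1 \<le> i \<and> 2 * i < d \<and>
        to_ac (a / b) = - (\<mu> ^ j) / to_ac b + (\<theta> ^ i + inverse (\<theta> ^ i)))"
      unfolding cheb_eq_0_iff[OF char_ac n_eq d \<theta>] shift by simp
    finally show ?thesis
      by (simp only: powi_eq)
  qed
  show ?thesis
    unfolding LCD ev by auto
qed

theorem theorem6p3:
  fixes a b :: "'a::{finite,field}"
    and n k r m t k' :: nat
    and \<mu> :: "'a alg_closure"
  assumes char: "CHAR('a) = 2"
    and b: "b \<noteq> 0"
    and n: "n \<ge> 2"
    and k: "k \<ge> 1"
    and r: "n + 1 = 2 ^ r * (m + 1)"
    and r_largest: "\<And>r' m'. n + 1 = 2 ^ r' * (m' + 1) \<Longrightarrow> r' \<le> r"
    and k': "k = 2 ^ t * k'" "gcd k' (card (UNIV :: 'a set)) = 1"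
    and mu: "primitive_root_of_unity k' \<mu>"
  shows "(r = 0 \<longrightarrow>
            (\<forall>\<theta> :: 'a alg_closure. primitive_root_of_unity (n + 1) \<theta> \<longrightarrow>
              (is_LCD (2 * n) (toeplitz_code n k a b) \<longleftrightarrow>
                 to_ac (a / b) \<notin>
                   {- (\<mu> ^ j) / to_ac b + \<theta> powi (int i) + \<theta> powi (- int i) | i j.
                      1 \<le> i \<and> real i \<le> real n / 2 \<and> 1 \<le> j \<and> j \<le> k'}))) \<and>
         (r \<ge> 1 \<and> m \<ge> 1 \<longrightarrow>
            (\<forall>\<theta> :: 'a alg_closure. primitive_root_of_unity (m + 1) \<theta> \<longrightarrow>
              (is_LCD (2 * n) (toeplitz_code n k a b) \<longleftrightarrow>
                 to_ac (a / b) \<notin>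
                   {- (\<mu> ^ j) / to_ac b | j. 1 \<le> j \<and> j \<le> k'} \<union>
                   {- (\<mu> ^ j) / to_ac b + \<theta> powi (int i) + \<theta> powi (- int i) | i j.
                      1 \<le> i \<and> real i \<le> real m / 2 \<and> 1 \<le> j \<and> j \<le> k'}))) \<and>
         (r \<ge> 1 \<and> m = 0 \<longrightarrow>
            (is_LCD (2 * n) (toeplitz_code n k a b) \<longleftrightarrow>
               to_ac a \<notin> {\<mu> ^ j | j. 1 \<le> j \<and> j \<le> k'}))"
proof -
  \<comment> \<open>If m + 1 were even, another factor 2 could be moved into the power, against the
    maximality of \<open>r\<close>.\<close>
  have "\<not> 2 dvd m + 1"
  proof
    assume "2 dvd m + 1"
    then obtain q where "m + 1 = 2 * q" ..
    then have "n + 1 = 2 ^ Suc r * ((q - 1) + 1)"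
      using r by (cases q) auto
    then show False
      using r_largest[of "Suc r" "q - 1"] by simp
  qed
  then have odd: "odd (m + 1)" .
  have "2 dvd card (UNIV :: 'a set)"
    using CHAR_dvd_CARD[where ?'a = 'a] char by simp
  then have "odd k'"
    using k'(2) by (metis gcd_greatest not_is_unit_0 odd_one)
  \<comment> \<open>All three cases are instances with d = m + 1; for \<open>r = 0\<close> this is n
    + 1.\<close>
  note LCD = is_LCD_toeplitz_code_iff[OF char b _ r odd k'(1) this mu]
  have le_half: "real i \<le> real m / 2 \<longleftrightarrow> 2 * i < m + 1" for i
    by auto
  have r0: "n = m" if "r = 0"
    using r that by simp
  show ?thesis
  proof (intro conjI impI allI)
    fix \<theta> :: "'a alg_closure"
    assume "r = 0" "primitive_root_of_unity (n + 1) \<theta>"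
    then show "is_LCD (2 * n) (toeplitz_code n k a b) \<longleftrightarrow>
                 to_ac (a / b) \<notin>
                   {- (\<mu> ^ j) / to_ac b + \<theta> powi (int i) + \<theta> powi (- int i) | i j.
                      1 \<le> i \<and> real i \<le> real n / 2 \<and> 1 \<le> j \<and> j \<le> k'}"
      using n LCD[of \<theta>] le_half unfolding r0[OF \<open>r = 0\<close>] by auto
  next
    fix \<theta> :: "'a alg_closure"
    assume "r \<ge> 1 \<and> m \<ge> 1" "primitive_root_of_unity (m + 1) \<theta>"
    then show "is_LCD (2 * n) (toeplitz_code n k a b) \<longleftrightarrow>
                 to_ac (a / b) \<notin>
                   {- (\<mu> ^ j) / to_ac b | j. 1 \<le> j \<and> j \<le> k'} \<union>
                   {- (\<mu> ^ j) / to_ac b + \<theta> powi (int i) + \<theta> powi (- int i) | i j.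
                      1 \<le> i \<and> real i \<le> real m / 2 \<and> 1 \<le> j \<and> j \<le> k'}"
      using n LCD[of \<theta>] le_half by auto
  next
    assume r1: "r \<ge> 1 \<and> m = 0"
    \<comment> \<open>For \<open>m = 0\<close> take \<theta> = 1; no \<open>i \<ge> 1\<close>
      satisfies \<open>2 * i < 1\<close>, so only the zero at \<open>x = 0\<close> remains.\<close>
    have "primitive_root_of_unity (m + 1) (1 :: 'a alg_closure)"
      using r1 by (simp add: primitive_root_of_unity_def)
    moreover have "to_ac (a / b) = - (\<mu> ^ j) / to_ac b \<longleftrightarrow> to_ac a = \<mu> ^ j" for j
      using b by (subst uminus_CHAR_2) (simp_all add: char)
    ultimately show "is_LCD (2 * n) (toeplitz_code n k a b) \<longleftrightarrow>
               to_ac a \<notin> {\<mu> ^ j | j. 1 \<le> j \<and> j \<le> k'}"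
      using n r1 LCD[of 1] by auto
  qed
qed

end
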